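(* Let $n\ge 2$ and let $M\in\mathbb{R}^{n\times n}$ be a singular matrix. There exists an $n$-dimensional affine subset $A$ of $\mathbb{R}^{n\times n}$ such that $M\in A$ and such that for every singular vector space $S\subset\mathbb{R}^{n\times n}$ (over $\mathbb{R}$) with $M\in S$ and $\max\{\operatorname{rank} C: C\in S\}=\operatorname{rank} M$, the set $A$ intersects $S$ trivially, that is, $A\cap S=\{M\}$.
   Context: A singular vector space (over $\mathbb{R}$) is a linear subspace of $\mathbb{R}^{n\times n}$ all of whose elements are singular matrices. An $n$-dimensional affine subset is a translate of an $n$-dimensional linear subspace of $\mathbb{R}^{n\times n}$. The affine set $A$ depends only on $M$, not on $S$. *)

theory Defs
  imports "HOL-Analysis.Analysis"
begin

definition singular_matrix :: "real^'n^'n \<Rightarrow> bool" where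
  "singular_matrix C \<longleftrightarrow> \<not> invertible C"

definition singular_vector_space :: "(real^'n^'n) set \<Rightarrow> bool" where
  "singular_vector_space S \<longleftrightarrow> subspace S \<and> (\<forall>C\<in>S. singular_matrix C)"

definition affine_subset_of_dim :: "nat \<Rightarrow> ('a::real_vector) set \<Rightarrow> bool" where
  "affine_subset_of_dim d A \<longleftrightarrow> (\<exists>a L. subspace L \<and> dim L = d \<and> A = (\<lambda>x. a + x) ` L)"

lemma affine_subset_of_dim_iff:
  fixes A :: "('a::euclidean_space) set"
  shows "affine_subset_of_dim d A \<longleftrightarrow> affine A \<and> aff_dim A = int d"
proof
  assume "affine_subset_of_dim d A"
  then obtain a L where L: "subspace L" "dim L = d" "A = (\<lambda>x. a + x) ` L"
    unfolding affine_subset_of_dim_def by blast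
  have "affine A"
    using affine_translation[of L a] subspace_imp_affine[OF L(1)] L(3) by simp
  moreover have "aff_dim A = int d"
    using aff_dim_translation_eq[of a L] aff_dim_subspace[OF L(1)] L(2,3) by simp
  ultimately show "affine A \<and> aff_dim A = int d" by simp
next
  assume A: "affine A \<and> aff_dim A = int d"
  then have "A \<noteq> {}" by auto
  then obtain a where a: "a \<in> A" by blast
  define L where "L = (\<lambda>x. - a + x) ` A"
  have L: "subspace L"
    unfolding L_def using affine_diffs_subspace[of A a] A a by simp
  have "int (dim L) = aff_dim A"
    using aff_dim_translation_eq[of "- a" A] aff_dim_subspace[OF L] L_def by simp
  moreover have "A = (\<lambda>x. a + x) ` L"
    unfolding L_def by (simp add: image_image)
  ultimately show "affine_subset_of_dim d A"
    unfolding affine_subset_of_dim_def using A L by auto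
qed

text \<open>Ranks are bounded, so \<open>Max (rank ` S)\<close> is a genuine maximum for nonempty \<open>S\<close>.\<close>

lemma finite_rank_image: "finite (rank ` (S :: (real^'n^'m) set))"
proof (rule finite_subset)
  show "rank ` S \<subseteq> {..min CARD('m) CARD('n)}"
    using rank_bound by blast
qed simp

end

theory Submission
  imports Defs
begin

text \<open>
  Write \<open>M = G E\<close> with \<open>G\<close> invertible and \<open>E\<close> the orthogonal projection onto the row space of \<open>M\<close>,
  and let \<open>y\<close> be a unit vector in the kernel of \<open>M\<close>. The affine set is \<open>M + L\<close> with
  \<open>L = {G (u y\<^sup>T + y u\<^sup>T) | u}\<close>. If \<open>u \<noteq> 0\<close>, then for \<open>t = 1\<close> or \<open>t = 2\<close> the matrix
  \<open>E + t (u y\<^sup>T + y u\<^sup>T)\<close> is injective on the span of \<open>y\<close> and the range of \<open>E\<close>, so that the rank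
  of \<open>M + t G (u y\<^sup>T + y u\<^sup>T)\<close> exceeds that of \<open>M\<close>; hence no nonzero element of \<open>L\<close> lies in a
  space \<open>S\<close> in which \<open>M\<close> has maximal rank.
\<close>

section \<open>Rank, kernels and orthogonal complements\<close>

lemma rank_mult_invertible_left:
  fixes G :: "real^'n^'n" and A :: "real^'m^'n"
  assumes "invertible G"
  shows "rank (G ** A) = rank A"
proof (rule antisym)
  obtain H where "H ** G = mat 1"
    using assms unfolding invertible_def by blast
  then have "A = H ** (G ** A)"
    by (simp add: matrix_mul_assoc)
  then show "rank A \<le> rank (G ** A)"
    by (metis rank_mul_le_right)
qed (rule rank_mul_le_right)

lemma matrix_mult_scaleR_right:
  fixes A :: "real^'n^'m"
  shows "A ** (c *\<^sub>R B) = c *\<^sub>R (A ** B)"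
  by (simp add: vec_eq_iff matrix_matrix_mult_def sum_distrib_left mult.left_commute)

lemma dim_le_rank_if_inj:
  fixes A :: "real^'n^'m"
  assumes "subspace V" and "\<And>v. v \<in> V \<Longrightarrow> A *v v = 0 \<Longrightarrow> v = 0"
  shows "dim V \<le> rank A"
proof -
  have "inj_on ((*v) A) (span V)"
  proof (rule inj_onI)
    fix v w
    assume "v \<in> span V" "w \<in> span V" and eq: "A *v v = A *v w"
    then have "v - w \<in> V"
      using assms(1) by (metis span_eq_iff subspace_diff)
    moreover have "A *v (v - w) = 0"
      using eq by (simp add: matrix_vector_mult_diff_distrib)
    ultimately have "v - w = 0"
      by (rule assms(2))
    then show "v = w" by simp
  qed
  then have "dim V = dim ((*v) A ` V)"
    by (simp add: dim_image_eq)
  also have "\<dots> \<le> rank A"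
    unfolding rank_dim_range by (intro dim_subset) auto
  finally show ?thesis .
qed

lemma dim_orthogonal_range_matrix:
  fixes A :: "real^'n^'m"
  shows "dim {x. \<forall>y. x \<bullet> (A *v y) = 0} + rank A = CARD('m)"
proof -
  have "subspace (range ((*v) A))"
    by (simp add: linear_subspace_image)
  then have "dim {x \<in> UNIV. \<forall>z \<in> range ((*v) A). orthogonal z x} + rank A = DIM(real^'m)"
    using dim_subspace_orthogonal_to_vectors[of "range ((*v) A)" UNIV] by (simp add: rank_dim_range)
  then show ?thesis
    by (simp add: orthogonal_def inner_commute)
qed

lemma subspace_matrix_kernel:
  fixes A :: "real^'n^'m"
  shows "subspace {x. A *v x = 0}"
  by (intro subspaceI) (auto simp: matrix_vector_right_distrib matrix_vector_mult_scaleR)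

text \<open>The kernel is the orthogonal complement of the row space, that is, of the range of
  \<open>transpose A\<close>, which has the same rank as \<open>A\<close>.\<close>

lemma rank_nullity_matrix:
  fixes A :: "real^'n^'m"
  shows "dim {x. A *v x = 0} + rank A = CARD('n)"
proof -
  have "x \<bullet> (transpose A *v y) = (A *v x) \<bullet> y" for x y
    by (metis dot_lmul_matrix vector_transpose_matrix transpose_transpose)
  then have "{x. A *v x = 0} = {x. \<forall>y. x \<bullet> (transpose A *v y) = 0}"
    using inner_eq_zero_iff by fastforce
  then show ?thesis
    using dim_orthogonal_range_matrix[of "transpose A"] by (simp add: rank_transpose)
qed

section \<open>Factoring a square matrix through an orthogonal projection\<close>

lemma orthogonal_projection_exists:
  fixes K :: "('a::euclidean_space) set"
  assumes "subspace K"
  obtains P where "linear P" "\<And>x. P x \<in> K" "\<And>x. x \<in> K \<Longrightarrow> P x = x"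
    "\<And>x y. P x \<bullet> y = x \<bullet> P y"
proof -
  obtain B where B: "B \<subseteq> K" "pairwise orthogonal B" "\<And>b. b \<in> B \<Longrightarrow> norm b = 1"
    "independent B" "span B = K"
    using orthonormal_basis_subspace[OF assms] by metis
  have fin: "finite B"
    using B(4) by (rule independent_imp_finite)
  define P where "P x = (\<Sum>b\<in>B. (x \<bullet> b) *\<^sub>R b)" for x
  show thesis
  proof
    show "linear P"
      unfolding P_def
      by (intro linearI) (simp_all add: inner_add_left scaleR_add_left sum.distrib scaleR_sum_right)
    show "P x \<in> K" for x
      unfolding P_def using B(1) assms by (intro subspace_sum subspace_scale) auto
    show "P x = x" if "x \<in> K" for x
      unfolding P_def using orthonormal_basis_expand[of B x] B fin that by simp
    show "P x \<bullet> y = x \<bullet> P y" for x y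
      unfolding P_def by (simp add: inner_sum_left inner_sum_right inner_commute mult.commute)
  qed
qed

text \<open>\<open>G\<close> acts as \<open>M\<close> on the orthogonal complement of the kernel
  \<open>K\<close>, and on \<open>K\<close> as an isometry onto the orthogonal complement
  \<open>K'\<close> of the range of \<open>M\<close>; \<open>E\<close> is the projection with kernel
  \<open>K\<close>.\<close>

lemma matrix_eq_invertible_mult_projection:
  fixes M :: "real^'n^'n"
  obtains G E :: "real^'n^'n" where "invertible G" "M = G ** E"
    "\<And>x. E *v (E *v x) = E *v x" "\<And>x y. (E *v x) \<bullet> y = x \<bullet> (E *v y)"
proof -
  define K where "K = {x. M *v x = 0}"
  define K' where "K' = {x. \<forall>y. x \<bullet> (M *v y) = 0}"
  have K: "subspace K"
    unfolding K_def by (rule subspace_matrix_kernel)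
  have K': "subspace K'"
    unfolding K'_def by (intro subspaceI) (auto simp: inner_add_left)
  \<comment> \<open>Since \<open>M\<close> is square, both dimensions equal \<open>CARD('n)\<close>
    minus \<open>rank M\<close>.\<close>
  have "dim K = dim K'"
    using rank_nullity_matrix[of M] dim_orthogonal_range_matrix[of M]
    unfolding K_def K'_def by linarith
  then obtain f where f: "linear f" "f ` K = K'" and nf: "\<And>x. x \<in> K \<Longrightarrow> norm (f x) = norm x"
    using isometries_subspaces[OF K K'] by metis
  obtain P where P: "linear P" "\<And>x. P x \<in> K" "\<And>x. x \<in> K \<Longrightarrow> P x = x"
    "\<And>x y. P x \<bullet> y = x \<bullet> P y"
    using orthogonal_projection_exists[OF K] by metis
  define E where "E = matrix (\<lambda>x. x - P x)"
  define G where "G = matrix (\<lambda>x. M *v x + f (P x))"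
  have E: "E *v x = x - P x" for x
    unfolding E_def
    using fun_cong[OF matrix_vector_mul(2)] linear_compose_sub[OF linear_ident P(1)] by blast
  have G: "G *v x = M *v x + f (P x)" for x
    unfolding G_def
    using fun_cong[OF matrix_vector_mul(2)]
      linear_compose_add[OF matrix_vector_mul_linear linear_compose[OF P(1) f(1), unfolded o_def]]
    by blast
  have PE: "P (x - P x) = 0" for x
    using P by (simp add: linear_diff)
  have "x = 0" if "G *v x = 0" for x
  proof -
    \<comment> \<open>The two summands of \<open>G *v x\<close> are orthogonal, so both vanish when
      their sum does.\<close>
    have "f (P x) \<in> K'"
      using P(2) f(2) by blast
    then have "f (P x) \<bullet> (M *v x) = 0"
      by (simp add: K'_def)
    moreover have *: "f (P x) = - (M *v x)"
      using that G[of x] by (simp add: eq_neg_iff_add_eq_0 add.commute)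
    ultimately have "M *v x = 0"
      by simp
    then have "x \<in> K" and "f (P x) = 0"
      using * by (simp_all add: K_def)
    then show "x = 0"
      using P(3)[of x] nf[of x] by simp
  qed
  then have "invertible G"
    by (simp add: invertible_left_inverse matrix_left_invertible_ker)
  moreover have "M = G ** E"
  proof -
    have "M *v x = (G ** E) *v x" for x
    proof -
      have "M *v P x = 0"
        using P(2)[of x] by (simp add: K_def)
      then show ?thesis
        by (simp add: matrix_vector_mul_assoc[symmetric] E G matrix_vector_mult_diff_distrib
            linear_diff[OF P(1)] P(2,3) linear_0[OF f(1)])
    qed
    then show ?thesis
      by (simp add: matrix_eq)
  qed
  moreover have "E *v (E *v x) = E *v x" for x
    by (simp add: E PE)
  moreover have "(E *v x) \<bullet> y = x \<bullet> (E *v y)" for x y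
    by (simp add: E inner_diff_left inner_diff_right P(4))
  ultimately show thesis
    using that by blast
qed

section \<open>Symmetric perturbations of a projection\<close>

definition sym_outer :: "real^'n \<Rightarrow> real^'n \<Rightarrow> real^'n^'n" where
  "sym_outer u y = (\<chi> i j. u $ i * y $ j + y $ i * u $ j)"

lemma sym_outer_mult_vec: "sym_outer u y *v x = (y \<bullet> x) *\<^sub>R u + (u \<bullet> x) *\<^sub>R y"
  by (simp add: sym_outer_def vec_eq_iff matrix_vector_mult_def inner_vec_def
      sum.distrib sum_distrib_left algebra_simps)

lemma linear_sym_outer: "linear (\<lambda>u. sym_outer u y)"
  by (intro linearI) (simp_all add: sym_outer_def vec_eq_iff algebra_simps)

lemma add_inner_scaleR_eq_0D:
  fixes u y :: "'a::real_inner"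
  assumes "norm y = 1" and "u + (u \<bullet> y) *\<^sub>R y = 0"
  shows "u = 0"
proof -
  have "(u + (u \<bullet> y) *\<^sub>R y) \<bullet> y = 2 * (u \<bullet> y)"
    using assms(1) by (simp add: inner_add_left norm_eq_1)
  then show ?thesis
    using assms(2) by simp
qed

text \<open>Injectivity on the span of \<open>y\<close> and the range of \<open>E\<close>: if
  \<open>x + s *\<^sub>R y\<close> is in the kernel, applying \<open>E\<close> expresses
  \<open>x\<close> through \<open>s\<close>, and what remains is \<open>t * s\<close> times a vector
  that the choice of \<open>t\<close> keeps nonzero.\<close>

lemma rank_projection_add_sym_outer:
  fixes E :: "real^'n^'n"
  assumes idem: "\<And>x. E *v (E *v x) = E *v x"
    and sym: "\<And>x y. (E *v x) \<bullet> y = x \<bullet> (E *v y)"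
    and y: "norm y = 1" "E *v y = 0"
    and "u \<noteq> 0"
  obtains t :: real where "rank E < rank (E + t *\<^sub>R sym_outer u y)"
proof -
  define v where "v = E *v u"
  \<comment> \<open>The difference of the two sides is the vector that has to be nonzero at the end.
    Only the right side depends on \<open>t\<close>, so equality at both \<open>t = 1\<close> and
    \<open>t = 2\<close> forces \<open>v = 0\<close>, and then \<open>u = 0\<close>.\<close>
  have "\<exists>t. t \<noteq> 0 \<and> (u - v) + (u \<bullet> y) *\<^sub>R y \<noteq> (t * (v \<bullet> v)) *\<^sub>R y"
  proof (rule ccontr)
    assume "\<not> ?thesis"
    then have *: "(u - v) + (u \<bullet> y) *\<^sub>R y = (t * (v \<bullet> v)) *\<^sub>R y" if "t \<noteq> 0" for t
      using that by blast
    have "(1 * (v \<bullet> v)) *\<^sub>R y = (2 * (v \<bullet> v)) *\<^sub>R y"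
      using *[of 1] *[of 2] by (metis one_neq_zero zero_neq_numeral)
    moreover have "y \<noteq> 0"
      using y(1) by auto
    ultimately have "v \<bullet> v = 0"
      by (metis mult_right_cancel one_eq_numeral_iff scaleR_right_imp_eq semiring_norm(85))
    then have "v = 0" by simp
    then have "u + (u \<bullet> y) *\<^sub>R y = 0"
      using *[of 1] by simp
    then show False
      using add_inner_scaleR_eq_0D[OF y(1)] \<open>u \<noteq> 0\<close> by blast
  qed
  then obtain t where t: "t \<noteq> 0" "(u - v) + (u \<bullet> y) *\<^sub>R y \<noteq> (t * (v \<bullet> v)) *\<^sub>R y"
    by blast
  define R where "R = range ((*v) E)"
  have R: "subspace R"
    unfolding R_def by (simp add: linear_subspace_image)
  have ER: "E *v x = x" if "x \<in> R" for x
    using that idem unfolding R_def by auto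
  \<comment> \<open>\<open>E\<close> fixes \<open>R\<close> pointwise but kills the unit vector
    \<open>y\<close>, so adjoining \<open>y\<close> raises the dimension by one.\<close>
  have "y \<notin> span R"
    using R ER[of y] y by (metis norm_zero span_eq_iff zero_neq_one)
  then have "rank E + 1 = dim (span (insert y R))"
    by (simp add: rank_dim_range R_def dim_insert)
  also have "\<dots> \<le> rank (E + t *\<^sub>R sym_outer u y)"
  proof (rule dim_le_rank_if_inj)
    fix z
    assume "z \<in> span (insert y R)" and z0: "(E + t *\<^sub>R sym_outer u y) *v z = 0"
    then obtain s where "z - s *\<^sub>R y \<in> R"
      using R by (metis span_breakdown_eq span_eq_iff)
    then obtain x where x: "x \<in> R" "z = x + s *\<^sub>R y"
      by (metis diff_add_cancel)
    have yx: "y \<bullet> x = 0"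
      using sym[of x y] y(2) ER[OF x(1)] by (simp add: inner_commute)
    have ux: "u \<bullet> x = v \<bullet> x"
      using sym[of u x] ER[OF x(1)] by (simp add: v_def)
    have eq: "x + t *\<^sub>R (s *\<^sub>R u + (v \<bullet> x + s * (u \<bullet> y)) *\<^sub>R y) = 0"
      using z0 x yx ux y ER[OF x(1)]
      by (simp add: matrix_vector_mult_add_rdistrib scaleR_matrix_vector_assoc[symmetric]
          sym_outer_mult_vec matrix_vector_right_distrib matrix_vector_mult_scaleR
          inner_add_right norm_eq_1 algebra_simps)
    \<comment> \<open>\<open>E\<close> fixes \<open>x\<close>, sends \<open>u\<close> to
      \<open>v\<close> and kills \<open>y\<close>.\<close>
    have "E *v (x + t *\<^sub>R (s *\<^sub>R u + (v \<bullet> x + s * (u \<bullet> y)) *\<^sub>R y)) = 0"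
      by (simp add: eq)
    then have "x + (t * s) *\<^sub>R v = 0"
      using ER[OF x(1)] y(2)
      by (simp add: matrix_vector_right_distrib matrix_vector_mult_scaleR v_def)
    then have xv: "x = - (t * s) *\<^sub>R v"
      by (simp add: eq_neg_iff_add_eq_0)
    have "(t * s) *\<^sub>R ((u - v) + (u \<bullet> y) *\<^sub>R y - (t * (v \<bullet> v)) *\<^sub>R y) = 0"
      using eq unfolding xv by (simp add: algebra_simps)
    then have "s = 0"
      using t by simp
    then show "z = 0"
      using x(2) xv by simp
  qed simp
  finally show thesis
    by (intro that[of t]) simp
qed

section \<open>The affine set through \<open>M\<close> and its intersection with
  \<open>S\<close>\<close>

theorem theorem2p11:
  fixes M :: "real^'n^'n"
  assumes "CARD('n) \<ge> 2"
    and "singular_matrix M"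
  shows "\<exists>A :: (real^'n^'n) set.
    affine_subset_of_dim CARD('n) A \<and> M \<in> A \<and>
    (\<forall>S. singular_vector_space S \<and> M \<in> S \<and> Max (rank ` S) = rank M
      \<longrightarrow> A \<inter> S = {M})"
proof -
  obtain G E :: "real^'n^'n" where G: "invertible G" and ME: "M = G ** E"
    and E: "\<And>x. E *v (E *v x) = E *v x" "\<And>x y. (E *v x) \<bullet> y = x \<bullet> (E *v y)"
    using matrix_eq_invertible_mult_projection[of M] by metis
  have "\<not> invertible E"
    using assms(2) G invertible_mult[of G E] unfolding singular_matrix_def ME by blast
  then obtain y0 where y0: "E *v y0 = 0" "y0 \<noteq> 0"
    unfolding invertible_left_inverse matrix_left_invertible_ker by blast
  define y where "y = y0 /\<^sub>R norm y0"
  have y: "norm y = 1" "E *v y = 0"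
    using y0 by (simp_all add: y_def matrix_vector_mult_scaleR)
  define N where "N u = G ** sym_outer u y" for u
  have N: "linear N"
    unfolding N_def
    by (intro linearI)
      (simp_all add: linear_add[OF linear_sym_outer] linear_scale[OF linear_sym_outer]
        matrix_add_ldistrib matrix_mult_scaleR_right)
  have rank_gt: "\<exists>t. rank M < rank (M + t *\<^sub>R N u)" if u: "u \<noteq> 0" for u
  proof -
    obtain t where "rank E < rank (E + t *\<^sub>R sym_outer u y)"
      using rank_projection_add_sym_outer[OF E y u] .
    moreover have "M + t *\<^sub>R N u = G ** (E + t *\<^sub>R sym_outer u y)"
      by (simp add: ME N_def matrix_add_ldistrib matrix_mult_scaleR_right)
    ultimately show ?thesis
      using rank_mult_invertible_left[OF G] ME by metis
  qed
  \<comment> \<open>If \<open>N u = 0\<close> with \<open>u \<noteq> 0\<close>, the strict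
    inequality would read \<open>rank M < rank M\<close>.\<close>
  then have "inj N"
    using N by (metis add_0_right less_irrefl linear_injective_0 scaleR_zero_right)
  then have "dim (range N) = CARD('n)"
    using N by (simp add: dim_image_eq)
  then have "affine_subset_of_dim CARD('n) ((+) M ` range N)"
    unfolding affine_subset_of_dim_def using linear_subspace_image[OF N subspace_UNIV] by blast
  moreover have "M \<in> (+) M ` range N"
    using linear_0[OF N] by (metis add_0_right image_eqI rangeI)
  moreover have "(+) M ` range N \<inter> S = {M}"
    if S: "singular_vector_space S" "M \<in> S" "Max (rank ` S) = rank M" for S
  proof -
    \<comment> \<open>Being a subspace, \<open>S\<close> contains \<open>N u\<close> and hence the
      whole line \<open>M + t *\<^sub>R N u\<close>, so the rank may be tested at a \<open>t\<close>
      other than 1.\<close>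
    have "u = 0" if "M + N u \<in> S" for u
    proof (rule ccontr)
      assume "u \<noteq> 0"
      then obtain t where t: "rank M < rank (M + t *\<^sub>R N u)"
        using rank_gt by blast
      have sub: "subspace S"
        using S(1) by (simp add: singular_vector_space_def)
      then have "N u \<in> S"
        using subspace_diff[OF sub that S(2)] by simp
      then have "M + t *\<^sub>R N u \<in> S"
        using sub S(2) by (simp add: subspace_add subspace_scale)
      then have "rank (M + t *\<^sub>R N u) \<le> Max (rank ` S)"
        by (simp add: finite_rank_image)
      then show False
        using t S(3) by simp
    qed
    then show ?thesis
      using S(2) \<open>M \<in> (+) M ` range N\<close> linear_0[OF N] by fastforce
  qed
  ultimately show ?thesis
    by blast
qed

end
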